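(* Let $\mathcal G=(m,A,\boldsymbol r,\boldsymbol\tau,u)$ be a stateless mean field game with exponential discounting $u(r,t)=re^{-\beta t}$, $\beta>0$, whose sojourn-time function $\boldsymbol\tau$ is continuous and rate monotonous. Then $\mathcal G$ has a stationary equilibrium. Furthermore, a mass distribution $\boldsymbol\mu^\dagger\in\mathcal U_m(A)$ is a stationary equilibrium of $\mathcal G$ if and only if $$\frac{r_i}{e^{\beta\tau_i(\boldsymbol\mu^\dagger)}-1}\ \ge\ \frac{r_j}{e^{\beta\tau_j(\boldsymbol\mu^\dagger)}-1}\qquad\text{for all } i\in A^\dagger,\ j\in A,$$ where $A^\dagger=\{i\in A\mid \mu_i^\dagger>0\}$.
   Context: Game data: a total mass $m>0$ of nonatomic agents; a finite action set $A=\{1,\dots,n\}$, $n\ge2$; rewards $\boldsymbol r=(r_i)_{i\in A}$, $r_i>0$; for $s>0$ put $\mathcal U_s(A)=\{\boldsymbol\mu\in\mathbb R_{\ge0}^n\mid\sum_{i\in A}\mu_i=s\}$; sojourn-time functions $\tau_i:\bigcup_{s>0}\mathcal U_s(A)\to(0,\infty)$, $\boldsymbol\tau=(\tau_i)_{i\in A}$; a utility function $u(r,t)$ (present value of reward $r$ received at time $t$). The action rates are $x_i(\boldsymbol\mu)=\mu_i/\tau_i(\boldsymbol\mu)$. Continuous and rate monotonous: $\boldsymbol\tau$ is continuous on each $\mathcal U_s(A)$, and for all $\boldsymbol\mu,\boldsymbol\mu'\in\bigcup_{s>0}\mathcal U_s(A)$ and all $i\in A$, $x_i(\boldsymbol\mu)<x_i(\boldsymbol\mu')$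 implies $\tau_i(\boldsymbol\mu)\le\tau_i(\boldsymbol\mu')$. Strategies: $\mathcal P(A)$ is the set of probability vectors on $A$. A strategy is a sequence $\boldsymbol\sigma=(\sigma_k)_{k\ge1}\in\mathcal P(A)^{\mathbb N}$; the $k$th action $a_k$ is drawn from $\sigma_k$, independently over $k$. It is stationary if $\sigma_k$ does not depend on $k$ (then identified with an element of $\mathcal P(A)$). Given a vector of sojourn times $\boldsymbol\tau=(\tau_i)_{i\in A}$, the expected total utility is $$V(\boldsymbol\sigma,\boldsymbol\tau)=\mathbb E_{\boldsymbol\sigma}\Big[\sum_{k=1}^\infty u\Big(r_{a_k},\sum_{j=1}^k\tau_{a_j}\Big)\Big].$$ Stationary equilibrium: a pair $\boldsymbol\mu^\dagger\in\mathcal U_m(A)$, $\sigma^\dagger\in\mathcal P(A)$ such that (a) $\mu_i^\dagger=\theta\,\sigma^\dagger(i)\,\tau_i(\boldsymbol\mu^\dagger)$ for all $i\in A$, for some normalizing constant $\theta$ (so that $\sum_j\mu_j^\dagger=m$), and (b) $V(\sigma^\dagger,\boldsymbol\tau(\boldsymbol\mu^\dagger))=\sup_{\boldsymbol\sigma\in\mathcal P(A)^{\mathbb N}}V(\boldsymbol\sigma,\boldsymbol\tau(\boldsymbol\mu^\dagger))$. Since $\sigma^\dagger$ is determined by $\boldsymbol\mu^\dagger$ through (a), one says that $\boldsymbol\mu^\dagger$ itself is a stationary equilibrium. *)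

theory Defs
  imports "HOL-Probability.Probability"
begin

text \<open>
  The action set is a finite type \<open>'n\<close>, so that vectors indexed by actions are elements of
  \<open>real ^ 'n\<close>, and probability vectors on the action set are elements of \<open>'n pmf\<close>.
\<close>

definition mass_distributions :: "real \<Rightarrow> (real ^ 'n::finite) set" where
  "mass_distributions s = {\<mu>. (\<forall>i. 0 \<le> \<mu> $ i) \<and> (\<Sum>i\<in>UNIV. \<mu> $ i) = s}"

text \<open>
  Sojourn-time functions are meaningful only on the following set; their values elsewhere are
  irrelevant.
\<close>

definition all_mass_distributions :: "(real ^ 'n::finite) set" where
  "all_mass_distributions = (\<Union>s\<in>{0<..}. mass_distributions s)"

definition action_rate :: "(real ^ 'n \<Rightarrow> real ^ 'n) \<Rightarrow> real ^ 'n::finite \<Rightarrow> 'n \<Rightarrow> real" where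
  "action_rate \<tau> \<mu> i = \<mu> $ i / \<tau> \<mu> $ i"

definition continuous_sojourn :: "(real ^ 'n::finite \<Rightarrow> real ^ 'n) \<Rightarrow> bool" where
  "continuous_sojourn \<tau> \<longleftrightarrow> (\<forall>s>0. continuous_on (mass_distributions s) \<tau>)"

definition rate_monotonous :: "(real ^ 'n::finite \<Rightarrow> real ^ 'n) \<Rightarrow> bool" where
  "rate_monotonous \<tau> \<longleftrightarrow>
     (\<forall>\<mu>\<in>all_mass_distributions. \<forall>\<mu>'\<in>all_mass_distributions. \<forall>i.
        action_rate \<tau> \<mu> i < action_rate \<tau> \<mu>' i \<longrightarrow> \<tau> \<mu> $ i \<le> \<tau> \<mu>' $ i)"

definition exp_discount :: "real \<Rightarrow> real \<Rightarrow> real \<Rightarrow> real" where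
  "exp_discount \<beta> r t = r * exp (- \<beta> * t)"

text \<open>
  Strategies are numbered from \<open>0\<close>: \<open>\<sigma> k\<close> is the law of the \<open>(k+1)\<close>-st action. Independent
  drawing of the actions is expressed by the product measure on action sequences.
  For exponential discounting with positive sojourn times the series converges along every action
  sequence and its sum is a bounded random variable, so that the integral is the genuine
  expectation.
\<close>

definition expected_utility ::
    "(real \<Rightarrow> real \<Rightarrow> real) \<Rightarrow> real ^ 'n::finite \<Rightarrow> (nat \<Rightarrow> 'n pmf) \<Rightarrow> real ^ 'n \<Rightarrow> real" where
  "expected_utility u r \<sigma> t =
     (\<integral>a. (\<Sum>k. u (r $ a k) (\<Sum>j\<le>k. t $ a j)) \<partial>(\<Pi>\<^sub>M k\<in>UNIV. measure_pmf (\<sigma> k)))"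

text \<open>
  The supremum over all (not only stationary) strategies is taken in the extended reals, so that
  no boundedness is presupposed.
\<close>

definition stationary_equilibrium_pair ::
    "real \<Rightarrow> real ^ 'n::finite \<Rightarrow> (real ^ 'n \<Rightarrow> real ^ 'n) \<Rightarrow> (real \<Rightarrow> real \<Rightarrow> real) \<Rightarrow>
     real ^ 'n \<Rightarrow> 'n pmf \<Rightarrow> bool" where
  "stationary_equilibrium_pair m r \<tau> u \<mu> p \<longleftrightarrow>
     \<mu> \<in> mass_distributions m \<and>
     (\<exists>\<theta>. \<forall>i. \<mu> $ i = \<theta> * pmf p i * \<tau> \<mu> $ i) \<and>
     ereal (expected_utility u r (\<lambda>_. p) (\<tau> \<mu>)) =
       (SUP \<sigma>. ereal (expected_utility u r \<sigma> (\<tau> \<mu>)))"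

definition stationary_equilibrium ::
    "real \<Rightarrow> real ^ 'n::finite \<Rightarrow> (real ^ 'n \<Rightarrow> real ^ 'n) \<Rightarrow> (real \<Rightarrow> real \<Rightarrow> real) \<Rightarrow>
     real ^ 'n \<Rightarrow> bool" where
  "stationary_equilibrium m r \<tau> u \<mu> \<longleftrightarrow> (\<exists>p. stationary_equilibrium_pair m r \<tau> u \<mu> p)"

end

theory Submission
  imports Defs
begin

text \<open>
  Put \<open>d\<^sub>i = exp (- \<beta> t\<^sub>i)\<close> and \<open>c\<^sub>i = r\<^sub>i / (exp (\<beta> t\<^sub>i) - 1)\<close>, so that
  \<open>r\<^sub>i d\<^sub>i = c\<^sub>i (1 - d\<^sub>i)\<close>. Along every action sequence the total utility is therefore an average
  of the \<open>c\<^bsub>a k\<^esub>\<close> with telescoping weights \<open>(1 - d\<^bsub>a k\<^esub>) \<Prod>j<k. d\<^bsub>a j\<^esub>\<close> of total mass one. So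
  the best expected utility is \<open>max c\<close>, and a stationary strategy attains it exactly if it is
  supported on the maximisers of \<open>c\<close>. This is the stated characterisation; a mass distribution
  satisfying it is a solution of the variational inequality for the continuous field
  \<open>\<mu> \<mapsto> c (\<mu>)\<close> on the simplex, which exists by Brouwer's fixed point theorem.
\<close>

section \<open>Discounted utility as a weighted average\<close>

locale exponential_discounting =
  fixes \<beta> :: real and r t :: "real ^ 'n::finite"
  assumes beta_pos: "\<beta> > 0" and t_pos: "t $ i > 0"
begin

text \<open>The present value of repeating action \<open>i\<close> forever: the geometric series of
  \<open>r $ i * exp (- \<beta> * k * t $ i)\<close> over \<open>k \<ge> 1\<close>.\<close>

definition index :: "'n \<Rightarrow> real" where
  "index i = r $ i / (exp (\<beta> * t $ i) - 1)"

text \<open>The factor at the moment when action \<open>k\<close> starts: its own sojourn time is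
  excluded, and \<open>discount a 0 = 1\<close>.\<close>

definition discount :: "(nat \<Rightarrow> 'n) \<Rightarrow> nat \<Rightarrow> real" where
  "discount a k = exp (- \<beta> * (\<Sum>j<k. t $ a j))"

definition weight :: "(nat \<Rightarrow> 'n) \<Rightarrow> nat \<Rightarrow> real" where
  "weight a k = discount a k - discount a (Suc k)"

text \<open>The total utility along \<open>a\<close>, already in averaged form;
  \<open>exp_discount_eq\<close> matches it term by term with the series in
  \<open>expected_utility\<close>.\<close>

definition payoff :: "(nat \<Rightarrow> 'n) \<Rightarrow> real" where
  "payoff a = (\<Sum>k. index (a k) * weight a k)"

lemma weight_pos: "weight a k > 0"
  using beta_pos t_pos by (simp add: weight_def discount_def)

lemma weight_0: "weight a 0 = 1 - exp (- \<beta> * t $ a 0)"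
  by (simp add: weight_def discount_def)

lemma discount_tendsto_0: "discount a \<longlonglongrightarrow> 0"
proof -
  \<comment> \<open>Finitely many actions have a positive minimal sojourn time, so the discount
    decays at least geometrically.\<close>
  define s where "s = Min (range (\<lambda>i. t $ i))"
  have s: "s > 0" "s \<le> t $ i" for i
    using t_pos by (auto simp: s_def)
  have "discount a k \<le> exp (- \<beta> * s) ^ k" for k
  proof -
    have "real k * s \<le> (\<Sum>j<k. t $ a j)"
      using sum_bounded_below[of "{..<k}" s "\<lambda>j. t $ a j"] s by simp
    then have "\<beta> * (real k * s) \<le> \<beta> * (\<Sum>j<k. t $ a j)"
      using beta_pos by simp
    then show ?thesis
      by (simp add: discount_def mult_ac flip: exp_of_nat_mult)
  qed
  moreover have "(\<lambda>k. exp (- \<beta> * s) ^ k) \<longlonglongrightarrow> 0"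
    using beta_pos s by (intro LIMSEQ_realpow_zero) auto
  ultimately show ?thesis
    by (intro Lim_null_comparison[of "discount a" "\<lambda>k. exp (- \<beta> * s) ^ k"])
      (simp_all add: discount_def)
qed

lemma weight_sums_1: "weight a sums 1"
  using telescope_sums'[OF discount_tendsto_0[of a]]
  by (simp add: weight_def[abs_def]) (simp add: discount_def)

lemma exp_discount_eq:
  "exp_discount \<beta> (r $ a k) (\<Sum>j\<le>k. t $ a j) = index (a k) * weight a k"
proof -
  have "exp (\<beta> * t $ a k) - 1 \<noteq> 0"
    using beta_pos t_pos[of "a k"] by simp
  then have "index (a k) * (1 - exp (- \<beta> * t $ a k)) = r $ a k * exp (- \<beta> * t $ a k)"
    by (simp add: index_def field_simps exp_minus)
  moreover have "weight a k = discount a k * (1 - exp (- \<beta> * t $ a k))"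
    by (simp add: weight_def discount_def algebra_simps flip: exp_add)
  \<comment> \<open>The reward is paid at the end of the sojourn: the sum over
    \<open>j \<le> k\<close> exceeds that in \<open>discount a k\<close> by \<open>t $ a k\<close>,
    which yields the extra factor.\<close>
  moreover have "exp_discount \<beta> (r $ a k) (\<Sum>j\<le>k. t $ a j) =
      discount a k * (r $ a k * exp (- \<beta> * t $ a k))"
    by (simp add: exp_discount_def discount_def algebra_simps lessThan_Suc_atMost[symmetric]
        flip: exp_add)
  ultimately show ?thesis
    by (simp add: mult_ac)
qed

lemma expected_utility_eq:
  "expected_utility (exp_discount \<beta>) r \<sigma> t =
     (\<integral>a. payoff a \<partial>(\<Pi>\<^sub>M k\<in>UNIV. measure_pmf (\<sigma> k)))"
  unfolding expected_utility_def payoff_def exp_discount_eq ..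

text \<open>Dominates the series for absolute convergence and, as the weights sum to 1, bounds
  \<open>payoff\<close> uniformly, which gives integrability.\<close>

definition index_bound :: real where
  "index_bound = Max (range (\<lambda>i. \<bar>index i\<bar>))"

lemma abs_index_le: "\<bar>index i\<bar> \<le> index_bound"
  by (simp add: index_bound_def)

lemma summable_abs_payoff: "summable (\<lambda>k. \<bar>index (a k) * weight a k\<bar>)"
proof (rule summable_comparison_test)
  show "summable (\<lambda>k. index_bound * weight a k)"
    using weight_sums_1 by (intro summable_mult) (auto simp: sums_iff)
  show "\<exists>N. \<forall>k\<ge>N. norm \<bar>index (a k) * weight a k\<bar> \<le> index_bound * weight a k"
    using weight_pos[THEN less_imp_le] abs_index_le
    by (auto simp: abs_mult intro!: mult_right_mono)
qed

lemma payoff_sums: "(\<lambda>k. index (a k) * weight a k) sums payoff a"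
  unfolding payoff_def using summable_rabs_cancel[OF summable_abs_payoff] by (rule summable_sums)

text \<open>As the weights sum to 1, \<open>W - payoff a\<close> is the weighted sum of the
  nonnegative gaps \<open>W - index (a k)\<close>. Keeping only the term \<open>k = 0\<close> gives
  a loss that depends on the first action alone, which later yields strict inequality.\<close>

lemma payoff_le_gap:
  assumes "\<And>i. index i \<le> W"
  shows "payoff a \<le> W - (W - index (a 0)) * (1 - exp (- \<beta> * t $ a 0))"
proof -
  have *: "(\<lambda>k. (W - index (a k)) * weight a k) sums (W - payoff a)"
    using sums_diff[OF sums_mult[OF weight_sums_1, of W] payoff_sums]
    by (simp add: left_diff_distrib)
  have "(\<Sum>k\<in>{0}. (W - index (a k)) * weight a k) \<le> (\<Sum>k. (W - index (a k)) * weight a k)"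
    using * assms weight_pos[THEN less_imp_le] by (intro sum_le_suminf) (auto simp: sums_iff)
  then show ?thesis
    using * by (simp add: sums_iff weight_0)
qed

lemma payoff_le:
  assumes "\<And>i. index i \<le> W"
  shows "payoff a \<le> W"
proof -
  have "0 \<le> (W - index (a 0)) * (1 - exp (- \<beta> * t $ a 0))"
    using assms[of "a 0"] beta_pos t_pos[of "a 0"] by simp
  then show ?thesis
    using payoff_le_gap[OF assms, of a] by simp
qed

lemma payoff_eq:
  assumes "\<And>k. index (a k) = W"
  shows "payoff a = W"
  using sums_unique2[OF payoff_sums[of a]] sums_mult[OF weight_sums_1, of W a] assms by simp

lemma abs_payoff_le: "\<bar>payoff a\<bar> \<le> index_bound"
proof -
  have "- index_bound \<le> index (a k)" for k
    using abs_index_le[of "a k"] by (simp add: abs_le_iff)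
  then have "- index_bound * weight a k \<le> index (a k) * weight a k" for k
    using weight_pos[of a k] by (intro mult_right_mono) auto
  then have "- index_bound \<le> payoff a"
    using sums_le[OF _ sums_mult[OF weight_sums_1] payoff_sums, of "- index_bound" a] by simp
  moreover have "payoff a \<le> index_bound"
    using abs_index_le by (intro payoff_le) (simp add: abs_le_iff)
  ultimately show ?thesis by (simp add: abs_le_iff)
qed

section \<open>Optimal strategies\<close>

lemma measurable_coordinate:
  fixes f :: "'n \<Rightarrow> real"
  shows "(\<lambda>a. f (a k)) \<in> borel_measurable (\<Pi>\<^sub>M k\<in>UNIV. measure_pmf (\<sigma> k))"
  by (rule measurable_compose[OF measurable_component_singleton]) auto

lemma integrable_payoff: "integrable (\<Pi>\<^sub>M k\<in>UNIV. measure_pmf (\<sigma> k)) payoff"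
proof -
  interpret product_prob_space "\<lambda>k. measure_pmf (\<sigma> k)" UNIV
    by unfold_locales
  have "payoff \<in> borel_measurable (\<Pi>\<^sub>M k\<in>UNIV. measure_pmf (\<sigma> k))"
    unfolding payoff_def[abs_def] weight_def discount_def
    by (intro borel_measurable_suminf borel_measurable_times borel_measurable_diff
        borel_measurable_sum measurable_coordinate measurable_compose[OF _ borel_measurable_exp]
        borel_measurable_const)
  then show ?thesis
    using abs_payoff_le by (intro integrable_const_bound[where B = index_bound]) auto
qed

lemma expected_utility_le:
  assumes "\<And>i. index i \<le> W"
  shows "expected_utility (exp_discount \<beta>) r \<sigma> t \<le> W"
proof -
  interpret product_prob_space "\<lambda>k. measure_pmf (\<sigma> k)" UNIV
    by unfold_locales
  show ?thesis
    unfolding expected_utility_eq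
    using payoff_le[OF assms] by (intro integral_le_const integrable_payoff) auto
qed

text \<open>Almost surely each action lies in the support, hence, by countability, all of them do at
  once, and the payoff is constant.\<close>

lemma expected_utility_eq_if_support:
  assumes "\<And>i. i \<in> set_pmf p \<Longrightarrow> index i = W"
  shows "expected_utility (exp_discount \<beta>) r (\<lambda>_. p) t = W"
proof -
  let ?M = "\<Pi>\<^sub>M k\<in>(UNIV::nat set). measure_pmf p"
  interpret product_prob_space "\<lambda>k::nat. measure_pmf p" UNIV
    by unfold_locales
  have "AE a in ?M. a k \<in> set_pmf p" for k :: nat
    using AE_component[of k "\<lambda>x. x \<in> set_pmf p"] by (auto simp: AE_measure_pmf)
  then have "AE a in ?M. \<forall>k::nat. a k \<in> set_pmf p"
    by (simp add: AE_all_countable)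
  then have "AE a in ?M. payoff a = W"
    by eventually_elim (use assms in \<open>auto intro: payoff_eq\<close>)
  then have "(\<integral>a. payoff a \<partial>(?M)) = (\<integral>a. W \<partial>(?M))"
    using integrable_payoff[of "\<lambda>_. p"] by (intro integral_cong_AE) auto
  then show ?thesis
    by (simp add: expected_utility_eq P.prob_space)
qed

text \<open>The suboptimal \<open>i\<close> is the first action with positive probability, so the
  expected loss at step 0 alone is already positive.\<close>

lemma expected_utility_less_if_support:
  assumes W: "\<And>i. index i \<le> W" and i: "i \<in> set_pmf p" "index i < W"
  shows "expected_utility (exp_discount \<beta>) r (\<lambda>_. p) t < W"
proof -
  let ?M = "\<Pi>\<^sub>M k\<in>(UNIV::nat set). measure_pmf p"
  interpret product_prob_space "\<lambda>k::nat. measure_pmf p" UNIV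
    by unfold_locales
  define gap where "gap j = (W - index j) * (1 - exp (- \<beta> * t $ j))" for j
  have gap_nonneg: "gap j \<ge> 0" for j
    using W[of j] beta_pos t_pos[of j] by (simp add: gap_def)
  have "gap i > 0"
    using i beta_pos t_pos[of i] by (simp add: gap_def)
  then have "0 < gap i * pmf p i"
    using i by (simp add: pmf_positive)
  also have "\<dots> \<le> (\<Sum>j\<in>UNIV. gap j * pmf p j)"
    using member_le_sum[of i UNIV "\<lambda>j. gap j * pmf p j"] gap_nonneg by simp
  also have "\<dots> = (\<integral>j. gap j \<partial>measure_pmf p)"
    by (subst integral_measure_pmf_real[of UNIV]) auto
  \<comment> \<open>The marginal of the product measure at coordinate 0 is \<open>p\<close>.\<close>
  also have "\<dots> = (\<integral>j. gap j \<partial>distr ?M (measure_pmf p) (\<lambda>a. a 0))"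
    by (subst PiM_component) auto
  also have "\<dots> = (\<integral>a. gap (a 0) \<partial>?M)"
    by (intro integral_distr measurable_component_singleton) auto
  finally have pos: "0 < (\<integral>a. gap (a 0) \<partial>?M)" .
  have int: "integrable ?M (\<lambda>a. gap (a 0))"
    by (intro integrable_const_bound[where B = "Max (range gap)"] measurable_coordinate)
      (auto simp: gap_nonneg)
  have "(\<integral>a. payoff a \<partial>?M) \<le> (\<integral>a. W - gap (a 0) \<partial>?M)"
    using payoff_le_gap[OF W] int
    by (intro integral_mono integrable_payoff) (auto simp: gap_def)
  also have "\<dots> = W - (\<integral>a. gap (a 0) \<partial>?M)"
    using int by (simp add: P.prob_space)
  finally show ?thesis
    using pos by (simp add: expected_utility_eq)
qed

text \<open>The supremum is the maximal index \<open>W\<close>: no strategy exceeds it, and always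
  playing a maximiser \<open>l\<close> attains it. A stationary strategy reaches \<open>W\<close>
  exactly if its support avoids smaller indices.\<close>

lemma optimal_stationary_iff:
  "ereal (expected_utility (exp_discount \<beta>) r (\<lambda>_. p) t) =
      (SUP \<sigma>. ereal (expected_utility (exp_discount \<beta>) r \<sigma> t)) \<longleftrightarrow>
    (\<forall>i\<in>set_pmf p. \<forall>j. index j \<le> index i)"
proof -
  define W where "W = Max (range index)"
  have W: "index i \<le> W" for i
    by (simp add: W_def)
  have "W \<in> range index"
    unfolding W_def by (intro Max_in) auto
  then obtain l where l: "index l = W" by auto
  have "(SUP \<sigma>. ereal (expected_utility (exp_discount \<beta>) r \<sigma> t)) = ereal W"
  proof (rule antisym)
    have "expected_utility (exp_discount \<beta>) r (\<lambda>_. return_pmf l) t = W"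
      by (rule expected_utility_eq_if_support) (simp add: l)
    then show "ereal W \<le> (SUP \<sigma>. ereal (expected_utility (exp_discount \<beta>) r \<sigma> t))"
      by (metis SUP_upper UNIV_I)
  qed (simp add: SUP_le_iff expected_utility_le[OF W])
  moreover have "expected_utility (exp_discount \<beta>) r (\<lambda>_. p) t = W \<longleftrightarrow>
      (\<forall>i\<in>set_pmf p. index i = W)"
    using expected_utility_eq_if_support[of p W] expected_utility_less_if_support[OF W, of _ p]
      W order_le_less by (metis less_irrefl)
  moreover have "index i = W \<longleftrightarrow> (\<forall>j. index j \<le> index i)" for i
    using W l by (metis antisym)
  ultimately show ?thesis by simp
qed

end

section \<open>Equilibria\<close>

lemma stationary_strategy_exists:
  assumes "\<mu> \<in> mass_distributions m" "m > 0" "\<And>i. t $ i > 0"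
  obtains p :: "'n::finite pmf" and \<theta> where "\<And>i. \<mu> $ i = \<theta> * pmf p i * t $ i"
proof -
  \<comment> \<open>The balance condition is inverted: \<open>p\<close> must be proportional to the
    action rates, and \<open>\<theta>\<close> is the total rate.\<close>
  define \<theta> where "\<theta> = (\<Sum>i\<in>UNIV. \<mu> $ i / t $ i)"
  have nonneg: "\<mu> $ i / t $ i \<ge> 0" for i
    using assms by (auto simp: mass_distributions_def less_imp_le)
  have "\<theta> \<noteq> 0"
  proof
    assume "\<theta> = 0"
    then have "\<mu> $ i / t $ i = 0" for i
      unfolding \<theta>_def using nonneg by (subst (asm) sum_nonneg_eq_0_iff) auto
    then have "\<mu> $ i = 0" for i
      using assms(3) by (metis divide_eq_0_iff less_irrefl)
    then show False
      using assms by (simp add: mass_distributions_def)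
  qed
  moreover have "\<theta> \<ge> 0"
    unfolding \<theta>_def using nonneg by (intro sum_nonneg) auto
  ultimately have \<theta>: "\<theta> > 0" by simp
  define f where "f i = \<mu> $ i / t $ i / \<theta>" for i
  have f: "f i \<ge> 0" for i
    unfolding f_def using nonneg \<theta> by (rule divide_nonneg_pos)
  have "(\<Sum>i\<in>UNIV. f i) = 1"
    unfolding f_def sum_divide_distrib[symmetric] \<theta>_def[symmetric] using \<theta> by simp
  then have "(\<integral>\<^sup>+i. ennreal (f i) \<partial>count_space UNIV) = 1"
    using f by (simp add: nn_integral_count_space_finite sum_ennreal)
  then have "pmf (embed_pmf f) i = f i" for i
    using f by (intro pmf_embed_pmf) auto
  then have "\<mu> $ i = \<theta> * pmf (embed_pmf f) i * t $ i" for i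
    using \<theta> assms(3)[of i] by (simp add: f_def)
  then show thesis by (rule that)
qed

text \<open>Any \<open>p\<close> balanced with \<open>\<mu>\<close> has the same support as
  \<open>\<mu>\<close>, so optimality of \<open>p\<close> becomes a condition on the actions that
  carry mass; a balanced \<open>p\<close> always exists.\<close>

lemma stationary_equilibrium_iff:
  fixes \<mu> r :: "real ^ 'n::finite"
  assumes "m > 0" "\<beta> > 0" and \<mu>: "\<mu> \<in> mass_distributions m" and \<tau>: "\<And>i. \<tau> \<mu> $ i > 0"
  shows "stationary_equilibrium m r \<tau> (exp_discount \<beta>) \<mu> \<longleftrightarrow>
    (\<forall>i\<in>{i. \<mu> $ i > 0}. \<forall>j.
       r $ i / (exp (\<beta> * \<tau> \<mu> $ i) - 1) \<ge> r $ j / (exp (\<beta> * \<tau> \<mu> $ j) - 1))"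
proof -
  interpret exponential_discounting \<beta> r "\<tau> \<mu>"
    using assms by unfold_locales auto
  have supp: "{i. \<mu> $ i > 0} = set_pmf p" if p: "\<And>i. \<mu> $ i = \<theta> * pmf p i * \<tau> \<mu> $ i" for p \<theta>
  proof -
    \<comment> \<open>Otherwise every \<open>\<mu> $ i\<close> would be nonpositive, against the
      total mass \<open>m > 0\<close>.\<close>
    have "\<theta> > 0"
    proof (rule ccontr)
      assume "\<not> \<theta> > 0"
      then have "\<theta> * (pmf p i * \<tau> \<mu> $ i) \<le> 0" for i
        using \<tau>[of i] by (intro mult_nonpos_nonneg) auto
      then have "(\<Sum>i\<in>UNIV. \<mu> $ i) \<le> 0"
        by (intro sum_nonpos) (simp add: p mult.assoc)
      then show False
        using \<mu> \<open>m > 0\<close> by (simp add: mass_distributions_def)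
    qed
    then show ?thesis
      using \<tau> by (auto simp: p zero_less_mult_iff set_pmf_iff pmf_nonneg order_less_le
          dest: not_sym)
  qed
  obtain p \<theta> where "\<And>i. \<mu> $ i = \<theta> * pmf p i * \<tau> \<mu> $ i"
    using stationary_strategy_exists[OF \<mu> \<open>m > 0\<close> \<tau>] by metis
  with supp \<mu> show ?thesis
    unfolding stationary_equilibrium_def stationary_equilibrium_pair_def optimal_stationary_iff
      index_def by metis
qed

section \<open>Existence through a variational inequality on the simplex\<close>

lemma compact_mass_distributions: "compact (mass_distributions m :: (real ^ 'n::finite) set)"
proof -
  have "closed (mass_distributions m :: (real ^ 'n) set)"
    unfolding mass_distributions_def
    by (intro closed_Collect_conj closed_Collect_all closed_Collect_le closed_Collect_eq
        continuous_intros)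
  moreover have "norm \<mu> \<le> m" if "\<mu> \<in> mass_distributions m" for \<mu> :: "real ^ 'n"
    using norm_le_l1_cart[of \<mu>] that by (simp add: mass_distributions_def)
  ultimately show ?thesis
    by (auto simp: compact_eq_bounded_closed bounded_iff)
qed

lemma convex_mass_distributions: "convex (mass_distributions m :: (real ^ 'n::finite) set)"
proof (rule convexI)
  fix x y :: "real ^ 'n" and u v :: real
  assume "x \<in> mass_distributions m" "y \<in> mass_distributions m" "0 \<le> u" "0 \<le> v" "u + v = 1"
  then show "u *\<^sub>R x + v *\<^sub>R y \<in> mass_distributions m"
    by (simp add: mass_distributions_def sum.distrib flip: sum_distrib_left distrib_right)
qed

lemma axis_in_mass_distributions:
  "m \<ge> 0 \<Longrightarrow> axis i m \<in> mass_distributions m"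
  by (simp add: mass_distributions_def axis_def)

text \<open>The fixed points of \<open>x \<mapsto> proj (x + c x)\<close> are the solutions of the variational inequality.\<close>

lemma variational_inequality_solution:
  fixes c :: "'a::euclidean_space \<Rightarrow> 'a"
  assumes "compact K" "convex K" "K \<noteq> {}" "continuous_on K c"
  obtains x where "x \<in> K" "\<And>y. y \<in> K \<Longrightarrow> c x \<bullet> (y - x) \<le> 0"
proof -
  have closed: "closed K"
    using assms by (simp add: compact_imp_closed)
  obtain x where x: "x \<in> K" "closest_point K (x + c x) = x"
  proof (rule brouwer[OF assms(1-3), of "\<lambda>x. closest_point K (x + c x)"])
    show "continuous_on K (\<lambda>x. closest_point K (x + c x))"
      using assms closed
      by (intro continuous_on_compose2[OF continuous_on_closest_point[where t = UNIV]]
          continuous_intros subset_UNIV)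
    show "(\<lambda>x. closest_point K (x + c x)) \<in> K \<rightarrow> K"
      using assms closed by (auto intro: closest_point_in_set)
  qed
  \<comment> \<open>The vector from the projection of \<open>x + c x\<close> back to
    \<open>x + c x\<close> makes an obtuse or right angle with every direction into
    \<open>K\<close>; at a fixed point that vector is \<open>c x\<close>.\<close>
  show thesis
    using that[OF x(1)] closest_point_dot[OF assms(2) closed, of _ "x + c x"] x(2) by simp
qed

lemma mass_distribution_on_maximisers_exists:
  fixes c :: "real ^ 'n::finite \<Rightarrow> real ^ 'n"
  assumes "m \<ge> 0" "continuous_on (mass_distributions m) c"
  obtains \<mu> where "\<mu> \<in> mass_distributions m" "\<And>i j. \<mu> $ i > 0 \<Longrightarrow> c \<mu> $ j \<le> c \<mu> $ i"
proof -
  obtain \<mu> where \<mu>: "\<mu> \<in> mass_distributions m"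
    and vi: "\<And>\<nu>. \<nu> \<in> mass_distributions m \<Longrightarrow> c \<mu> \<bullet> (\<nu> - \<mu>) \<le> 0"
    using variational_inequality_solution[OF compact_mass_distributions convex_mass_distributions
        _ assms(2)] axis_in_mass_distributions[OF assms(1)] by blast
  have "c \<mu> $ j \<le> c \<mu> $ i" if "\<mu> $ i > 0" for i j
  proof (cases "i = j")
    case False
    \<comment> \<open>Test point for the variational inequality: all mass of action \<open>i\<close>
      is moved to \<open>j\<close>, so the inner product is \<open>\<mu> $ i\<close> times the
      difference of the two values of \<open>c\<close>.\<close>
    define \<nu> where "\<nu> = \<mu> + (axis j (\<mu> $ i) - axis i (\<mu> $ i))"
    have "\<nu> \<in> mass_distributions m"
      using \<mu> that False
      by (auto simp: \<nu>_def mass_distributions_def axis_def sum.distrib sum_subtractf)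
    from vi[OF this] have "\<mu> $ i * (c \<mu> $ j - c \<mu> $ i) \<le> 0"
      by (simp add: \<nu>_def inner_diff_right inner_axis algebra_simps)
    then show ?thesis
      using that by (simp add: mult_le_0_iff)
  qed simp
  with \<mu> show thesis by (rule that)
qed

theorem theorem1:
  fixes m \<beta> :: real
    and r :: "real ^ 'n::finite"
    and \<tau> :: "real ^ 'n \<Rightarrow> real ^ 'n"
  assumes "CARD('n) \<ge> 2"
    and "m > 0"
    and "\<And>i. r $ i > 0"
    and "\<And>\<mu> i. \<mu> \<in> all_mass_distributions \<Longrightarrow> \<tau> \<mu> $ i > 0"
    and "\<beta> > 0"
    and "continuous_sojourn \<tau>"
    and "rate_monotonous \<tau>"
  shows "(\<exists>\<mu>. stationary_equilibrium m r \<tau> (exp_discount \<beta>) \<mu>) \<and>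
    (\<forall>\<mu>\<in>mass_distributions m.
       stationary_equilibrium m r \<tau> (exp_discount \<beta>) \<mu> \<longleftrightarrow>
       (\<forall>i\<in>{i. \<mu> $ i > 0}. \<forall>j.
          r $ i / (exp (\<beta> * \<tau> \<mu> $ i) - 1) \<ge> r $ j / (exp (\<beta> * \<tau> \<mu> $ j) - 1)))"
proof -
  have \<tau>: "\<tau> \<mu> $ i > 0" if "\<mu> \<in> mass_distributions m" for \<mu> i
    using that assms by (auto simp: all_mass_distributions_def)
  note equilibrium_iff = stationary_equilibrium_iff[of m \<beta> _ \<tau>, OF \<open>m > 0\<close> \<open>\<beta> > 0\<close> _ \<tau>]
  define c :: "real ^ 'n \<Rightarrow> real ^ 'n"
    where "c \<mu> = (\<chi> i. r $ i / (exp (\<beta> * \<tau> \<mu> $ i) - 1))" for \<mu>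
  have "continuous_on (mass_distributions m) \<tau>"
    using assms by (simp add: continuous_sojourn_def)
  \<comment> \<open>Positive sojourn times keep the denominators nonzero, so \<open>c\<close>
    inherits continuity from \<open>\<tau>\<close>.\<close>
  moreover have "exp (\<beta> * \<tau> \<mu> $ i) - 1 \<noteq> 0" if "\<mu> \<in> mass_distributions m" for \<mu> i
    using \<tau>[OF that, of i] \<open>\<beta> > 0\<close> by simp
  ultimately have "continuous_on (mass_distributions m) c"
    unfolding c_def by (intro continuous_intros) auto
  then obtain \<mu> where "\<mu> \<in> mass_distributions m" "\<And>i j. \<mu> $ i > 0 \<Longrightarrow> c \<mu> $ j \<le> c \<mu> $ i"
    using mass_distribution_on_maximisers_exists[of m c] \<open>m > 0\<close> by (metis less_imp_le)
  then have "stationary_equilibrium m r \<tau> (exp_discount \<beta>) \<mu>"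
    using equilibrium_iff[of \<mu>] by (simp add: c_def)
  then show ?thesis
    using equilibrium_iff by blast
qed

end
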